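(* Let $p\colon E\to B$ be a regular arc-covering with $E$ path-connected, let $e_0\in E$ and $b_0=p(e_0)$. Then there is a natural monomorphism $DTG(p)\to \pi(p,b_0)$ (sending a deck transformation $h$ to the class of $p\circ\alpha_h$, where $\alpha_h$ is any path in $E$ from $e_0$ to $h(e_0)$). This monomorphism is an isomorphism if $DTG(p)$ acts transitively on the fibers of $p$.
   Context: All maps are continuous. A map $p\colon E\to B$ is an arc-covering if for every $e_0\in E$, $t_0\in[0,1]$ and map $f\colon[0,1]\to B$ with $f(t_0)=p(e_0)$ there is a unique map $g\colon[0,1]\to E$ with $p\circ g=f$ and $g(t_0)=e_0$ (a lift). An arc-covering is regular if for every loop $\alpha$ in $B$ either all lifts of $\alpha$ are loops or none of them are. The monodromy group $\pi(p,b_0)$ is the set of equivalence classes of loops in $B$ at $b_0$, where $\alpha\sim\beta$ iff for any lifts $\tilde\alpha,\tilde\beta$ with $\tilde\alpha(0)=\tilde\beta(0)$ one has $\tilde\alpha(1)=\tilde\beta(1)$; the group operation is $[\alpha]\cdot[\beta]=[\alpha\ast\beta]$ (concatenation). The deck transformation group $DTG(p)$ is the group of homeomorphisms $h\colon E\to E$ with $p\circ h=p$. *)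

theory Defs
  imports "HOL-Analysis.Analysis" "HOL-Algebra.Group"
begin

text \<open>A lift of a map f : [0,1] -> B to E (paths are maps on the unit interval;
  values outside [0,1] are irrelevant).\<close>
definition is_lift :: "'a topology \<Rightarrow> ('a \<Rightarrow> 'b) \<Rightarrow> (real \<Rightarrow> 'b) \<Rightarrow> (real \<Rightarrow> 'a) \<Rightarrow> bool" where
  "is_lift E p f g \<longleftrightarrow> pathin E g \<and> (\<forall>t\<in>{0..1}. p (g t) = f t)"

definition arc_covering :: "'a topology \<Rightarrow> 'b topology \<Rightarrow> ('a \<Rightarrow> 'b) \<Rightarrow> bool" where
  "arc_covering E B p \<longleftrightarrow> continuous_map E B p \<and>
     (\<forall>e0\<in>topspace E. \<forall>t0\<in>{0..1::real}. \<forall>f. pathin B f \<and> f t0 = p e0 \<longrightarrow>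
        (\<exists>g. is_lift E p f g \<and> g t0 = e0) \<and>
        (\<forall>g g'. is_lift E p f g \<and> g t0 = e0 \<and> is_lift E p f g' \<and> g' t0 = e0
                \<longrightarrow> (\<forall>t\<in>{0..1}. g t = g' t)))"

definition regular_arc_covering :: "'a topology \<Rightarrow> 'b topology \<Rightarrow> ('a \<Rightarrow> 'b) \<Rightarrow> bool" where
  "regular_arc_covering E B p \<longleftrightarrow> arc_covering E B p \<and>
     (\<forall>\<alpha>. pathin B \<alpha> \<and> \<alpha> 0 = \<alpha> 1 \<longrightarrow>
        (\<forall>g. is_lift E p \<alpha> g \<longrightarrow> g 1 = g 0) \<or> (\<forall>g. is_lift E p \<alpha> g \<longrightarrow> g 1 \<noteq> g 0))"

definition loop_at :: "'b topology \<Rightarrow> 'b \<Rightarrow> (real \<Rightarrow> 'b) \<Rightarrow> bool" where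
  "loop_at B b0 \<alpha> \<longleftrightarrow> pathin B \<alpha> \<and> \<alpha> 0 = b0 \<and> \<alpha> 1 = b0"

definition mono_equiv :: "'a topology \<Rightarrow> ('a \<Rightarrow> 'b) \<Rightarrow> (real \<Rightarrow> 'b) \<Rightarrow> (real \<Rightarrow> 'b) \<Rightarrow> bool" where
  "mono_equiv E p \<alpha> \<beta> \<longleftrightarrow>
     (\<forall>ga gb. is_lift E p \<alpha> ga \<and> is_lift E p \<beta> gb \<and> ga 0 = gb 0 \<longrightarrow> ga 1 = gb 1)"

definition mono_class :: "'a topology \<Rightarrow> 'b topology \<Rightarrow> ('a \<Rightarrow> 'b) \<Rightarrow> 'b \<Rightarrow> (real \<Rightarrow> 'b) \<Rightarrow> (real \<Rightarrow> 'b) set" where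
  "mono_class E B p b0 \<alpha> = {\<beta>. loop_at B b0 \<beta> \<and> mono_equiv E p \<alpha> \<beta>}"

text \<open>Concatenation of paths (same formula as joinpaths, for arbitrary types).\<close>
definition concat_path :: "(real \<Rightarrow> 'b) \<Rightarrow> (real \<Rightarrow> 'b) \<Rightarrow> real \<Rightarrow> 'b" where
  "concat_path \<alpha> \<beta> = (\<lambda>t. if t \<le> 1/2 then \<alpha> (2 * t) else \<beta> (2 * t - 1))"

definition monodromy_group :: "'a topology \<Rightarrow> 'b topology \<Rightarrow> ('a \<Rightarrow> 'b) \<Rightarrow> 'b \<Rightarrow> (real \<Rightarrow> 'b) set monoid" where
  "monodromy_group E B p b0 =
     \<lparr>carrier = {mono_class E B p b0 \<alpha> | \<alpha>. loop_at B b0 \<alpha>},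
      mult = (\<lambda>X Y. mono_class E B p b0 (concat_path (SOME \<alpha>. \<alpha> \<in> X) (SOME \<beta>. \<beta> \<in> Y))),
      one = mono_class E B p b0 (\<lambda>t. b0)\<rparr>"

text \<open>The deck transformation group; deck transformations are normalised to be the
  identity outside the underlying set of E, so that they are determined by their action on E.\<close>
definition DTG :: "'a topology \<Rightarrow> ('a \<Rightarrow> 'b) \<Rightarrow> ('a \<Rightarrow> 'a) monoid" where
  "DTG E p =
     \<lparr>carrier = {h. homeomorphic_map E E h \<and> (\<forall>x\<in>topspace E. p (h x) = p x)
                  \<and> (\<forall>x. x \<notin> topspace E \<longrightarrow> h x = x)},
      mult = (\<lambda>h k. h \<circ> k),
      one = id\<rparr>"

definition acts_transitively_on_fibers :: "'a topology \<Rightarrow> ('a \<Rightarrow> 'b) \<Rightarrow> bool" where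
  "acts_transitively_on_fibers E p \<longleftrightarrow>
     (\<forall>x\<in>topspace E. \<forall>y\<in>topspace E. p x = p y \<longrightarrow> (\<exists>h\<in>carrier (DTG E p). h x = y))"

end

theory Submission
  imports Defs
begin

text \<open>By regularity, whether a loop lifts to a loop does not depend on the starting point.
  Applied to \<open>\<beta> \<cdot> \<gamma>\<^sup>-\<^sup>1\<close>, it shows that two loops at \<open>b\<^sub>0\<close> whose lifts from one point end at the
  same point have this property from every starting point, i.e. are monodromy equivalent. Hence
  the class of a loop is determined by the endpoint of its lift from \<open>e\<^sub>0\<close>, which lies in the
  fibre over \<open>b\<^sub>0\<close>. A deck transformation \<open>h\<close> is sent to the class whose lift from \<open>e\<^sub>0\<close> ends at
  \<open>h e\<^sub>0\<close>; since \<open>h\<close> maps lifts to lifts and \<open>E\<close> is path-connected, \<open>h\<close> is determined by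
  \<open>h e\<^sub>0\<close>, so this map is an injective homomorphism, and it is onto when every point of the fibre
  has the form \<open>h e\<^sub>0\<close>.\<close>

definition rev_path :: "(real \<Rightarrow> 'b) \<Rightarrow> real \<Rightarrow> 'b" where
  "rev_path g = (\<lambda>t. g (1 - t))"

lemma pathin_concat_path:
  assumes g1: "pathin X g1" and g2: "pathin X g2" and e: "g2 0 = g1 1"
  shows "pathin X (concat_path g1 g2)"
  unfolding pathin_def concat_path_def
proof -
  let ?T01 = "top_of_set {0..1::real}"
  let ?g = "\<lambda>x. if x \<le> 1/2 then (g1 \<circ> (\<lambda>t. 2 * t)) x else (g2 \<circ> (\<lambda>t. 2 * t -1)) x"
  have "continuous_map (subtopology euclideanreal {0..1}) X ?g"
  proof (intro continuous_map_cases_le continuous_map_compose, force, force)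
    show "continuous_map (subtopology ?T01 {x \<in> topspace ?T01. x \<le> 1/2}) ?T01 ((*) 2)"
      by (auto simp: continuous_map_in_subtopology continuous_map_from_subtopology)
    have "continuous_map
           (subtopology (top_of_set {0..1}) {x. 0 \<le> x \<and> x \<le> 1 \<and> 1 \<le> x * 2})
           euclideanreal (\<lambda>t. 2 * t - 1)"
      by (intro continuous_intros) (force intro: continuous_map_from_subtopology)
    then show "continuous_map (subtopology ?T01 {x \<in> topspace ?T01. 1/2 \<le> x}) ?T01 (\<lambda>t. 2 * t - 1)"
      by (force simp: continuous_map_in_subtopology)
    show "(g1 \<circ> (*) 2) x = (g2 \<circ> (\<lambda>t. 2 * t - 1)) x" if "x = 1/2" for x
    proof -
      have "2 * x = 1" using that by simp
      then show ?thesis by (simp add: e)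
    qed
  qed (use g1 g2 in \<open>auto simp: pathin_def\<close>)
  then show "continuous_map (subtopology euclideanreal {0..1}) X
      (\<lambda>t. if t \<le> 1 / 2 then g1 (2 * t) else g2 (2 * t - 1))"
    by (rule continuous_map_eq) auto
qed

lemma pathin_rev_path: "pathin X g \<Longrightarrow> pathin X (rev_path g)"
  unfolding pathin_def rev_path_def
  by (rule continuous_map_compose[of _ "subtopology euclideanreal {0..1}" "\<lambda>t. 1 - t", unfolded o_def])
    (auto intro!: continuous_map_compose simp: continuous_map_in_subtopology continuous_on_op_minus)

lemma loop_at_concat_path:
  "loop_at B b0 \<alpha> \<Longrightarrow> loop_at B b0 \<beta> \<Longrightarrow> loop_at B b0 (concat_path \<alpha> \<beta>)"
  by (simp add: loop_at_def pathin_concat_path) (simp add: concat_path_def)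

lemma is_lift_concat_path:
  assumes g1: "is_lift E p f1 g1" and g2: "is_lift E p f2 g2" and e: "g2 0 = g1 1"
  shows "is_lift E p (concat_path f1 f2) (concat_path g1 g2)"
  unfolding is_lift_def
proof (intro conjI ballI)
  show "pathin E (concat_path g1 g2)"
    using assms by (simp add: is_lift_def pathin_concat_path)
  fix t :: real assume "t \<in> {0..1}"
  then have "t \<le> 1/2 \<Longrightarrow> 2 * t \<in> {0..1}" "\<not> t \<le> 1/2 \<Longrightarrow> 2 * t - 1 \<in> {0..1}"
    by auto
  with g1 g2 show "p (concat_path g1 g2 t) = concat_path f1 f2 t"
    by (auto simp: is_lift_def concat_path_def)
qed

lemma is_lift_rev_path: "is_lift E p f g \<Longrightarrow> is_lift E p (rev_path f) (rev_path g)"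
  using pathin_rev_path[of E g] by (simp add: is_lift_def rev_path_def)

lemma is_lift_compose_self: "pathin E \<alpha> \<Longrightarrow> is_lift E p (p \<circ> \<alpha>) \<alpha>"
  by (simp add: is_lift_def)

lemma is_lift_cong: "(\<And>t. t \<in> {0..1} \<Longrightarrow> f t = f' t) \<Longrightarrow> is_lift E p f g = is_lift E p f' g"
  by (simp add: is_lift_def)

lemma is_lift_imp_pathin:
  assumes "continuous_map E B p" and "is_lift E p f g"
  shows "pathin B f"
proof -
  have "pathin B (p \<circ> g)"
    using assms pathin_compose by (auto simp: is_lift_def)
  then show ?thesis
    unfolding pathin_def by (rule continuous_map_eq) (use assms(2) in \<open>auto simp: is_lift_def\<close>)
qed

lemma arc_coveringD:
  assumes "arc_covering E B p" and "e \<in> topspace E" and "t0 \<in> {0..1}" and "pathin B f" and "f t0 = p e"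
  shows arc_covering_lift_exists: "\<exists>g. is_lift E p f g \<and> g t0 = e"
    and arc_covering_lift_unique:
      "\<lbrakk>is_lift E p f g; g t0 = e; is_lift E p f g'; g' t0 = e; t \<in> {0..1}\<rbrakk> \<Longrightarrow> g t = g' t"
proof -
  have "(\<exists>g. is_lift E p f g \<and> g t0 = e) \<and>
        (\<forall>g g'. is_lift E p f g \<and> g t0 = e \<and> is_lift E p f g' \<and> g' t0 = e
                \<longrightarrow> (\<forall>t\<in>{0..1}. g t = g' t))"
    using assms unfolding arc_covering_def by blast
  then show "\<exists>g. is_lift E p f g \<and> g t0 = e"
    and "\<lbrakk>is_lift E p f g; g t0 = e; is_lift E p f g'; g' t0 = e; t \<in> {0..1}\<rbrakk> \<Longrightarrow> g t = g' t"
    by blast+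
qed

context
  fixes E :: "'a topology" and B :: "'b topology" and p :: "'a \<Rightarrow> 'b"
  assumes arc: "arc_covering E B p"
begin

lemma lift_exists:
  assumes "e \<in> topspace E" and "pathin B f" and "f 0 = p e"
  obtains g where "is_lift E p f g" and "g 0 = e"
  using arc_covering_lift_exists[OF arc assms(1) _ assms(2,3)] by auto

lemma lift_unique:
  assumes g: "is_lift E p f g" and g': "is_lift E p f g'" and "g 0 = g' 0" and "t \<in> {0..1}"
  shows "g t = g' t"
proof (rule arc_covering_lift_unique[OF arc _ _ _ _ g refl g'])
  show "pathin B f"
    using arc g by (auto simp: arc_covering_def intro: is_lift_imp_pathin)
  show "g 0 \<in> topspace E" and "f 0 = p (g 0)"
    using g by (auto simp: is_lift_def path_start_in_topspace)
qed (use assms in auto)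

lemma mono_equiv_refl: "mono_equiv E p \<alpha> \<alpha>"
  unfolding mono_equiv_def using lift_unique by auto

lemma mono_equiv_trans:
  assumes "loop_at B b0 \<alpha>" and "loop_at B b0 \<beta>"
    and ab: "mono_equiv E p \<alpha> \<beta>" and bc: "mono_equiv E p \<beta> \<gamma>"
  shows "mono_equiv E p \<alpha> \<gamma>"
  unfolding mono_equiv_def
proof (intro allI impI)
  fix ga gc assume a: "is_lift E p \<alpha> ga \<and> is_lift E p \<gamma> gc \<and> ga 0 = gc 0"
  then have "is_lift E p \<alpha> ga" by simp
  then have "ga 0 \<in> topspace E" and "\<beta> 0 = p (ga 0)"
    using assms(1,2) by (auto simp: is_lift_def loop_at_def path_start_in_topspace)
  then obtain gb where gb: "is_lift E p \<beta> gb" "gb 0 = ga 0"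
    using lift_exists assms(2) by (metis loop_at_def)
  have "ga 1 = gb 1" using ab a gb by (simp add: mono_equiv_def)
  also have "\<dots> = gc 1" using bc a gb by (simp add: mono_equiv_def)
  finally show "ga 1 = gc 1" .
qed

lemma mono_class_eqI:
  assumes la: "loop_at B b0 \<alpha>" and lb: "loop_at B b0 \<alpha>'" and e: "mono_equiv E p \<alpha> \<alpha>'"
  shows "mono_class E B p b0 \<alpha> = mono_class E B p b0 \<alpha>'"
proof -
  have e': "mono_equiv E p \<alpha>' \<alpha>"
    using e unfolding mono_equiv_def by metis
  have "mono_equiv E p \<alpha> \<beta> = mono_equiv E p \<alpha>' \<beta>" for \<beta>
    using mono_equiv_trans[OF la lb e] mono_equiv_trans[OF lb la e'] by blast
  then show ?thesis unfolding mono_class_def by simp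
qed

lemma self_in_mono_class: "loop_at B b0 \<alpha> \<Longrightarrow> \<alpha> \<in> mono_class E B p b0 \<alpha>"
  by (simp add: mono_class_def mono_equiv_refl)

end

text \<open>The lift of \<open>\<beta> \<cdot> \<gamma>\<^sup>-\<^sup>1\<close> through the given lifts is a loop, hence by regularity so is every
  lift of it, in particular the one starting with an arbitrary lift \<open>ga\<close> of \<open>\<beta>\<close>; its second half
  is then the reverse of the lift of \<open>\<gamma>\<close> from \<open>ga 0\<close> and ends at \<open>ga 1\<close>.\<close>

lemma mono_equiv_if_lifts_meet:
  assumes reg: "regular_arc_covering E B p"
    and lb: "loop_at B b0 \<beta>" and lc: "loop_at B b0 \<gamma>"
    and gb: "is_lift E p \<beta> g\<beta>" and gc: "is_lift E p \<gamma> g\<gamma>"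
    and start: "g\<beta> 0 = g\<gamma> 0" and finish: "g\<beta> 1 = g\<gamma> 1"
  shows "mono_equiv E p \<beta> \<gamma>"
  unfolding mono_equiv_def
proof (intro allI impI)
  fix ga gc
  assume a: "is_lift E p \<beta> ga \<and> is_lift E p \<gamma> gc \<and> ga 0 = gc 0"
  have arc: "arc_covering E B p" using reg by (simp add: regular_arc_covering_def)
  define L where "L = concat_path \<beta> (rev_path \<gamma>)"
  have prg: "pathin B (rev_path \<gamma>)" using lc by (simp add: loop_at_def pathin_rev_path)
  have "pathin B L" unfolding L_def
    by (rule pathin_concat_path[OF _ prg]) (use lb lc in \<open>auto simp: loop_at_def rev_path_def\<close>)
  moreover have "L 0 = L 1"
    using lb lc by (simp add: L_def concat_path_def rev_path_def loop_at_def)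
  moreover have "is_lift E p L (concat_path g\<beta> (rev_path g\<gamma>))" unfolding L_def
    by (rule is_lift_concat_path[OF gb is_lift_rev_path[OF gc]]) (simp add: rev_path_def finish)
  moreover have "concat_path g\<beta> (rev_path g\<gamma>) 1 = concat_path g\<beta> (rev_path g\<gamma>) 0"
    using start by (simp add: concat_path_def rev_path_def)
  ultimately have L_lifts_loop: "\<And>g. is_lift E p L g \<Longrightarrow> g 1 = g 0"
    using reg unfolding regular_arc_covering_def by metis
  have "ga 1 \<in> topspace E" "rev_path \<gamma> 0 = p (ga 1)"
    using a lb lc by (auto simp: is_lift_def loop_at_def rev_path_def path_finish_in_topspace)
  then obtain r where r: "is_lift E p (rev_path \<gamma>) r" "r 0 = ga 1"
    using lift_exists[OF arc _ prg] by metis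
  have "is_lift E p L (concat_path ga r)" unfolding L_def
    by (rule is_lift_concat_path) (use a r in auto)
  then have "concat_path ga r 1 = concat_path ga r 0"
    by (rule L_lifts_loop)
  then have "r 1 = ga 0"
    by (simp add: concat_path_def)
  have "is_lift E p \<gamma> (rev_path r)"
    using is_lift_rev_path[OF r(1)] by (subst is_lift_cong) (auto simp: rev_path_def)
  then have "rev_path r 1 = gc 1"
    by (rule lift_unique[OF arc]) (use a \<open>r 1 = ga 0\<close> in \<open>auto simp: rev_path_def\<close>)
  then show "ga 1 = gc 1" using r(2) by (simp add: rev_path_def)
qed

lemma DTG_carrierD:
  assumes "h \<in> carrier (DTG E p)"
  shows "continuous_map E E h" and "\<And>x. x \<in> topspace E \<Longrightarrow> p (h x) = p x"
    and "\<And>x. x \<notin> topspace E \<Longrightarrow> h x = x"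
  using assms by (simp_all add: DTG_def homeomorphic_imp_continuous_map)

lemma DTG_mult: "h \<otimes>\<^bsub>DTG E p\<^esub> k = h \<circ> k"
  by (simp add: DTG_def)

lemma DTG_image_in_topspace: "h \<in> carrier (DTG E p) \<Longrightarrow> x \<in> topspace E \<Longrightarrow> h x \<in> topspace E"
  using DTG_carrierD(1) continuous_map_funspace by blast

lemma DTG_compose_closed:
  assumes h: "h \<in> carrier (DTG E p)" and k: "k \<in> carrier (DTG E p)"
  shows "h \<circ> k \<in> carrier (DTG E p)"
proof -
  have "homeomorphic_map E E (h \<circ> k)"
    using h k homeomorphic_map_compose by (auto simp: DTG_def)
  moreover have "p (h (k x)) = p x" if "x \<in> topspace E" for x
    using that DTG_carrierD(2)[OF h] DTG_carrierD(2)[OF k] DTG_image_in_topspace[OF k] by simp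
  moreover have "h (k x) = x" if "x \<notin> topspace E" for x
    using that DTG_carrierD(3)[OF h] DTG_carrierD(3)[OF k] by simp
  ultimately show ?thesis
    by (simp add: DTG_def)
qed

lemma is_lift_deck_compose:
  assumes "h \<in> carrier (DTG E p)" and "is_lift E p f g"
  shows "is_lift E p f (h \<circ> g)"
  using assms DTG_carrierD[OF assms(1)] path_image_subset_topspace pathin_compose
  by (fastforce simp: is_lift_def)

text \<open>Paths from \<open>e\<^sub>0\<close> are lifts of their projections, so \<open>h \<circ> \<gamma>\<close> and \<open>k \<circ> \<gamma>\<close> are lifts with a
  common start and hence a common end.\<close>

lemma deck_transformation_eqI:
  assumes arc: "arc_covering E B p" and pc: "path_connected_space E" and e0: "e0 \<in> topspace E"
    and h: "h \<in> carrier (DTG E p)" and k: "k \<in> carrier (DTG E p)" and eq: "h e0 = k e0"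
  shows "h = k"
proof
  fix x
  show "h x = k x"
  proof (cases "x \<in> topspace E")
    case True
    then obtain \<gamma> where \<gamma>: "pathin E \<gamma>" "\<gamma> 0 = e0" "\<gamma> 1 = x"
      using pc e0 by (auto simp: path_connected_space_def)
    have "(h \<circ> \<gamma>) 1 = (k \<circ> \<gamma>) 1"
      by (rule lift_unique[OF arc is_lift_deck_compose[OF h] is_lift_deck_compose[OF k]])
        (use is_lift_compose_self[OF \<gamma>(1)] \<gamma>(2) eq in auto)
    then show ?thesis using \<gamma> by simp
  qed (use DTG_carrierD(3)[OF h] DTG_carrierD(3)[OF k] in simp)
qed

locale based_regular_arc_covering =
  fixes E :: "'a topology" and B :: "'b topology" and p :: "'a \<Rightarrow> 'b" and e0 :: 'a
  assumes regular: "regular_arc_covering E B p"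
    and path_connected: "path_connected_space E"
    and base_point: "e0 \<in> topspace E"
begin

lemma arc: "arc_covering E B p"
  using regular by (simp add: regular_arc_covering_def)

lemma loop_at_project_path_to_deck_image:
  assumes "h \<in> carrier (DTG E p)" and "pathin E \<alpha>" "\<alpha> 0 = e0" "\<alpha> 1 = h e0"
  shows "loop_at B (p e0) (p \<circ> \<alpha>)"
  using assms arc pathin_compose DTG_carrierD(2)[OF assms(1) base_point]
  by (auto simp: loop_at_def arc_covering_def)

lemma path_to_deck_image:
  assumes "h \<in> carrier (DTG E p)"
  obtains \<alpha> where "pathin E \<alpha>" "\<alpha> 0 = e0" "\<alpha> 1 = h e0"
  using path_connected base_point DTG_image_in_topspace[OF assms base_point]
  unfolding path_connected_space_def by blast

lemma lift_from_base_point: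
  assumes "loop_at B (p e0) \<beta>"
  obtains g where "is_lift E p \<beta> g" and "g 0 = e0"
  using lift_exists[OF arc base_point] assms unfolding loop_at_def by blast

definition deck_monodromy :: "('a \<Rightarrow> 'a) \<Rightarrow> (real \<Rightarrow> 'b) set" where
  "deck_monodromy h = mono_class E B p (p e0) (p \<circ> (SOME \<alpha>. pathin E \<alpha> \<and> \<alpha> 0 = e0 \<and> \<alpha> 1 = h e0))"

lemma mono_class_eq_deck_monodromy:
  assumes h: "h \<in> carrier (DTG E p)" and l: "loop_at B (p e0) \<beta>"
    and g: "is_lift E p \<beta> g" "g 0 = e0" "g 1 = h e0"
  shows "mono_class E B p (p e0) \<beta> = deck_monodromy h"
proof -
  define \<alpha> where "\<alpha> = (SOME \<alpha>. pathin E \<alpha> \<and> \<alpha> 0 = e0 \<and> \<alpha> 1 = h e0)"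
  have "\<exists>\<alpha>. pathin E \<alpha> \<and> \<alpha> 0 = e0 \<and> \<alpha> 1 = h e0"
    using path_to_deck_image[OF h] by blast
  then have "pathin E \<alpha> \<and> \<alpha> 0 = e0 \<and> \<alpha> 1 = h e0"
    unfolding \<alpha>_def by (rule someI_ex)
  then have \<alpha>: "pathin E \<alpha>" "\<alpha> 0 = e0" "\<alpha> 1 = h e0"
    by simp_all
  have l\<alpha>: "loop_at B (p e0) (p \<circ> \<alpha>)"
    using loop_at_project_path_to_deck_image[OF h \<alpha>] .
  have "mono_equiv E p \<beta> (p \<circ> \<alpha>)"
    by (rule mono_equiv_if_lifts_meet[OF regular l l\<alpha> g(1) is_lift_compose_self[OF \<alpha>(1)]])
      (use g \<alpha> in simp_all)
  then show ?thesis
    unfolding deck_monodromy_def \<alpha>_def[symmetric] by (rule mono_class_eqI[OF arc l l\<alpha>])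
qed

lemma deck_monodromy_eq:
  assumes "h \<in> carrier (DTG E p)" and "pathin E \<alpha>" "\<alpha> 0 = e0" "\<alpha> 1 = h e0"
  shows "deck_monodromy h = mono_class E B p (p e0) (p \<circ> \<alpha>)"
  using mono_class_eq_deck_monodromy[OF assms(1) loop_at_project_path_to_deck_image[OF assms]
      is_lift_compose_self[OF assms(2)] assms(3,4)]
  by simp

lemma project_path_in_deck_monodromy:
  assumes "h \<in> carrier (DTG E p)" and "pathin E \<alpha>" "\<alpha> 0 = e0" "\<alpha> 1 = h e0"
  shows "p \<circ> \<alpha> \<in> deck_monodromy h"
  using deck_monodromy_eq[OF assms] self_in_mono_class[OF arc loop_at_project_path_to_deck_image[OF assms]]
  by simp

lemma deck_monodromy_nonempty: "h \<in> carrier (DTG E p) \<Longrightarrow> \<exists>\<beta>. \<beta> \<in> deck_monodromy h"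
  using path_to_deck_image project_path_in_deck_monodromy by metis

lemma deck_monodromy_in_carrier:
  assumes h: "h \<in> carrier (DTG E p)"
  shows "deck_monodromy h \<in> carrier (monodromy_group E B p (p e0))"
proof -
  obtain \<alpha> where \<alpha>: "pathin E \<alpha>" "\<alpha> 0 = e0" "\<alpha> 1 = h e0"
    using path_to_deck_image[OF h] .
  then have "loop_at B (p e0) (p \<circ> \<alpha>)"
    by (rule loop_at_project_path_to_deck_image[OF h])
  then show ?thesis
    using deck_monodromy_eq[OF h \<alpha>] by (auto simp: monodromy_group_def)
qed

lemma lift_end_of_mem_deck_monodromy:
  assumes k: "k \<in> carrier (DTG E p)" and \<beta>: "\<beta> \<in> deck_monodromy k"
    and g: "is_lift E p \<beta> g" "g 0 = e0"
  shows "g 1 = k e0"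
proof -
  obtain \<alpha> where \<alpha>: "pathin E \<alpha>" "\<alpha> 0 = e0" "\<alpha> 1 = k e0"
    using path_to_deck_image[OF k] .
  have "mono_equiv E p (p \<circ> \<alpha>) \<beta>"
    using \<beta> deck_monodromy_eq[OF k \<alpha>] by (simp add: mono_class_def)
  then have "\<alpha> 1 = g 1"
    using is_lift_compose_self[OF \<alpha>(1)] g \<alpha>(2) unfolding mono_equiv_def by blast
  then show ?thesis
    using \<alpha>(3) by simp
qed

text \<open>Translating by \<open>h\<close> moves the lift from \<open>e\<^sub>0\<close> to the lift from \<open>h e\<^sub>0\<close>.\<close>

lemma lift_end_of_mem_deck_monodromy_from_image:
  assumes h: "h \<in> carrier (DTG E p)" and k: "k \<in> carrier (DTG E p)"
    and \<beta>: "\<beta> \<in> deck_monodromy k" and g: "is_lift E p \<beta> g" "g 0 = h e0"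
  shows "g 1 = h (k e0)"
proof -
  have "loop_at B (p e0) \<beta>"
    using \<beta> by (simp add: deck_monodromy_def mono_class_def)
  then obtain g0 where g0: "is_lift E p \<beta> g0" "g0 0 = e0"
    by (rule lift_from_base_point)
  have "g 1 = (h \<circ> g0) 1"
    using lift_unique[OF arc g(1) is_lift_deck_compose[OF h g0(1)]] g(2) g0(2) by simp
  then show ?thesis
    using lift_end_of_mem_deck_monodromy[OF k \<beta> g0] by simp
qed

lemma deck_monodromy_hom:
  "deck_monodromy \<in> hom (DTG E p) (monodromy_group E B p (p e0))"
proof (rule homI)
  fix h k assume h: "h \<in> carrier (DTG E p)" and k: "k \<in> carrier (DTG E p)"
  define \<beta>1 where "\<beta>1 = (SOME \<beta>. \<beta> \<in> deck_monodromy h)"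
  define \<beta>2 where "\<beta>2 = (SOME \<beta>. \<beta> \<in> deck_monodromy k)"
  have \<beta>: "\<beta>1 \<in> deck_monodromy h" "\<beta>2 \<in> deck_monodromy k"
    using someI_ex[OF deck_monodromy_nonempty[OF h]] someI_ex[OF deck_monodromy_nonempty[OF k]]
    by (simp_all add: \<beta>1_def \<beta>2_def)
  then have l: "loop_at B (p e0) \<beta>1" "loop_at B (p e0) \<beta>2"
    by (simp_all add: deck_monodromy_def mono_class_def)
  obtain g1 where g1: "is_lift E p \<beta>1 g1" "g1 0 = e0"
    using lift_from_base_point[OF l(1)] .
  have "h e0 \<in> topspace E" "\<beta>2 0 = p (h e0)"
    using l(2) DTG_image_in_topspace[OF h base_point] DTG_carrierD(2)[OF h base_point]
    by (auto simp: loop_at_def)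
  then obtain g2 where g2: "is_lift E p \<beta>2 g2" "g2 0 = h e0"
    using lift_exists[OF arc _ _] l(2) unfolding loop_at_def by blast
  have "is_lift E p (concat_path \<beta>1 \<beta>2) (concat_path g1 g2)"
    using is_lift_concat_path[OF g1(1) g2(1)] lift_end_of_mem_deck_monodromy[OF h \<beta>(1) g1] g2(2)
    by simp
  moreover have "concat_path g1 g2 0 = e0"
    using g1(2) by (simp add: concat_path_def)
  moreover have "concat_path g1 g2 1 = (h \<circ> k) e0"
    using lift_end_of_mem_deck_monodromy_from_image[OF h k \<beta>(2) g2] by (simp add: concat_path_def)
  ultimately have "mono_class E B p (p e0) (concat_path \<beta>1 \<beta>2) = deck_monodromy (h \<circ> k)"
    by (rule mono_class_eq_deck_monodromy[OF DTG_compose_closed[OF h k] loop_at_concat_path[OF l]])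
  then show "deck_monodromy (h \<otimes>\<^bsub>DTG E p\<^esub> k)
      = deck_monodromy h \<otimes>\<^bsub>monodromy_group E B p (p e0)\<^esub> deck_monodromy k"
    by (simp add: DTG_mult monodromy_group_def \<beta>1_def \<beta>2_def)
qed (use deck_monodromy_in_carrier in blast)

lemma deck_monodromy_inj: "inj_on deck_monodromy (carrier (DTG E p))"
proof (rule inj_onI)
  fix h k assume h: "h \<in> carrier (DTG E p)" and k: "k \<in> carrier (DTG E p)"
    and eq: "deck_monodromy h = deck_monodromy k"
  obtain \<alpha> where \<alpha>: "pathin E \<alpha>" "\<alpha> 0 = e0" "\<alpha> 1 = k e0"
    using path_to_deck_image[OF k] .
  then have "p \<circ> \<alpha> \<in> deck_monodromy h"
    using eq project_path_in_deck_monodromy[OF k] by simp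
  then have "\<alpha> 1 = h e0"
    using lift_end_of_mem_deck_monodromy[OF h _ is_lift_compose_self[OF \<alpha>(1)] \<alpha>(2)] by simp
  then show "h = k"
    using \<alpha>(3) by (intro deck_transformation_eqI[OF arc path_connected base_point h k]) simp
qed

lemma deck_monodromy_surj:
  assumes transitive: "acts_transitively_on_fibers E p"
  shows "deck_monodromy ` carrier (DTG E p) = carrier (monodromy_group E B p (p e0))"
proof
  show "deck_monodromy ` carrier (DTG E p) \<subseteq> carrier (monodromy_group E B p (p e0))"
    using deck_monodromy_in_carrier by blast
next
  show "carrier (monodromy_group E B p (p e0)) \<subseteq> deck_monodromy ` carrier (DTG E p)"
  proof
    fix X assume "X \<in> carrier (monodromy_group E B p (p e0))"
    then obtain \<beta> where X: "X = mono_class E B p (p e0) \<beta>" and l: "loop_at B (p e0) \<beta>"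
      by (auto simp: monodromy_group_def)
    obtain g where g: "is_lift E p \<beta> g" "g 0 = e0"
      using lift_from_base_point[OF l] .
    have "g 1 \<in> topspace E" "p e0 = p (g 1)"
      using g l by (auto simp: is_lift_def loop_at_def path_finish_in_topspace)
    then obtain h where h: "h \<in> carrier (DTG E p)" "h e0 = g 1"
      using transitive[unfolded acts_transitively_on_fibers_def, rule_format, OF base_point] by auto
    have "X = deck_monodromy h"
      using mono_class_eq_deck_monodromy[OF h(1) l g] h(2) X by simp
    then show "X \<in> deck_monodromy ` carrier (DTG E p)"
      using h(1) by blast
  qed
qed

end

theorem proposition2p10:
  fixes E :: "'a topology" and B :: "'b topology" and p :: "'a \<Rightarrow> 'b"
  assumes "regular_arc_covering E B p"
    and "path_connected_space E"
    and "e0 \<in> topspace E"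
    and "b0 = p e0"
  shows "\<exists>\<phi>. \<phi> \<in> hom (DTG E p) (monodromy_group E B p b0)
            \<and> inj_on \<phi> (carrier (DTG E p))
            \<and> (\<forall>h\<in>carrier (DTG E p). \<forall>\<alpha>. pathin E \<alpha> \<and> \<alpha> 0 = e0 \<and> \<alpha> 1 = h e0
                  \<longrightarrow> \<phi> h = mono_class E B p b0 (p \<circ> \<alpha>))
            \<and> (acts_transitively_on_fibers E p
                  \<longrightarrow> \<phi> \<in> iso (DTG E p) (monodromy_group E B p b0))"
proof -
  interpret based_regular_arc_covering E B p e0
    using assms(1-3) by unfold_locales
  show ?thesis
    unfolding assms(4)
  proof (intro exI conjI ballI allI impI)
    show "deck_monodromy \<in> hom (DTG E p) (monodromy_group E B p (p e0))"
      by (rule deck_monodromy_hom)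
    show "inj_on deck_monodromy (carrier (DTG E p))"
      by (rule deck_monodromy_inj)
    show "deck_monodromy h = mono_class E B p (p e0) (p \<circ> \<alpha>)"
      if "h \<in> carrier (DTG E p)" and "pathin E \<alpha> \<and> \<alpha> 0 = e0 \<and> \<alpha> 1 = h e0" for h \<alpha>
      using deck_monodromy_eq that by blast
    show "deck_monodromy \<in> iso (DTG E p) (monodromy_group E B p (p e0))"
      if "acts_transitively_on_fibers E p"
      using deck_monodromy_hom deck_monodromy_inj deck_monodromy_surj[OF that]
      by (simp add: iso_def bij_betw_def)
  qed
qed

end
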